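(* Let $(c_d)_{d\ge 0}$ be the asymptotic degree distribution of the random graph process (version 1) described in the context, i.e. $c_d=\lim_{n\to\infty}X[n,d]/(n+1)$ almost surely. Then $$c_d\sim (e\pi)^{1/2}\,d^{1/4}\,e^{-2\sqrt d}\quad\text{as } d\to\infty,$$ that is, the ratio of the two sides tends to $1$ as $d\to\infty$.
   Context: Random graph process, version 1: the process starts (after $0$ steps) with the graph consisting of a single vertex and no edges. It evolves in discrete steps; one new vertex is born at each step, so there are $n+1$ vertices after $n$ steps. The graph is always simple. At each step, two (not necessarily different) old vertices $u,v$ (i.e. vertices already present before the step) are chosen independently of each other and of the past, each uniformly at random among all old vertices. Duplication part: the new vertex is added to the graph and connected by an edge to $u$ and to every neighbour of $u$. Deletion part: afterwards, all edges emanating from $v$ are deleted, except that edges incident to the new vertex are not deleted (so if $v$ is connected to the new vertex, that edge is kept). $X[n,d]$ denotes the number of vertices of degree $d$ after $n$ steps. For every $d\ge0$ the proportion $X[n,d]/(n+1)$ converges almost surely, as $n\to\infty$, to a deterministic positive number, denoted $c_d$; these numbers satisfy $c_0=\frac{1+c_1}{3}$ and $c_d=\frac{d+1}{2d+3}(c_{d-1}+c_{d+1})$ for $d\ge 1$. *)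

theory Defs
  imports "HOL-Probability.Probability" "HOL-Library.Landau_Symbols"
begin

text \<open>Simple graphs are given by their set of edges, each edge being a two-element set of vertices.\<close>

definition neighbours :: "'a set set \<Rightarrow> 'a \<Rightarrow> 'a set" where
  "neighbours E u = {w. {u, w} \<in> E}"

definition vertex_degree :: "'a set set \<Rightarrow> 'a \<Rightarrow> nat" where
  "vertex_degree E u = card (neighbours E u)"

definition duplicate :: "'a set set \<Rightarrow> 'a \<Rightarrow> 'a \<Rightarrow> 'a set set" where
  "duplicate E x u = E \<union> {{x, w} | w. w = u \<or> w \<in> neighbours E u}"

definition delete_old_edges :: "'a set set \<Rightarrow> 'a \<Rightarrow> 'a \<Rightarrow> 'a set set" where
  "delete_old_edges E x v = {e \<in> E. v \<in> e \<longrightarrow> x \<in> e}"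

text \<open>
  Vertices are numbered in order of birth, so the vertex set after \<open>n\<close> steps is \<open>{..n}\<close> and
  the vertex born in step \<open>n + 1\<close> is \<open>Suc n\<close>. The old vertices chosen in that step
  for duplication and deletion are \<open>u n\<close> and \<open>v n\<close>.
\<close>

primrec graph_edges :: "(nat \<Rightarrow> nat) \<Rightarrow> (nat \<Rightarrow> nat) \<Rightarrow> nat \<Rightarrow> nat set set" where
  "graph_edges u v 0 = {}"
| "graph_edges u v (Suc n) =
     delete_old_edges (duplicate (graph_edges u v n) (Suc n) (u n)) (Suc n) (v n)"

definition degree_count :: "(nat \<Rightarrow> nat) \<Rightarrow> (nat \<Rightarrow> nat) \<Rightarrow> nat \<Rightarrow> nat \<Rightarrow> nat" where
  "degree_count u v n d = card {w \<in> {..n}. vertex_degree (graph_edges u v n) w = d}"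

text \<open>The graph stays simple, with edges only between existing vertices.\<close>

lemma graph_edges_simple:
  assumes "\<And>n. u n \<le> n"
  shows "e \<in> graph_edges u v n \<Longrightarrow> e \<subseteq> {..n} \<and> card e = 2"
proof (induction n arbitrary: e)
  case (Suc n)
  have 1: "e \<subseteq> {..Suc n} \<and> card e = 2" if "e \<in> graph_edges u v n"
    using Suc.IH[OF that] by auto
  have 2: "{Suc n, w} \<subseteq> {..Suc n} \<and> card {Suc n, w} = 2"
    if "w = u n \<or> {u n, w} \<in> graph_edges u v n" for w
  proof -
    have "w \<le> n" using that Suc.IH[of "{u n, w}"] assms[of n] by auto
    then show ?thesis by auto
  qed
  from Suc.prems show ?case
    using 1 2 by (auto simp: delete_old_edges_def duplicate_def neighbours_def)
qed simp

text \<open>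
  Mutual independence of all the choices says that the two choices of each step are independent of
  each other and of the past.
\<close>

locale duplication_deletion_process = prob_space M
  for M :: "'w measure" +
  fixes U V :: "nat \<Rightarrow> 'w \<Rightarrow> nat"
  assumes indep_choices: "indep_vars (\<lambda>_. count_space UNIV) (case_sum U V) UNIV"
    and U_uniform: "\<And>n. distr M (count_space UNIV) (U n) = measure_pmf (pmf_of_set {..n})"
    and V_uniform: "\<And>n. distr M (count_space UNIV) (V n) = measure_pmf (pmf_of_set {..n})"

end

theory Submission imports Defs "HOL-Real_Asymp.Real_Asymp"
begin

text \<open>
  Taking expectations turns the random question into one about a linear recurrence. Averaged over
  the two choices of a step, a vertex of degree \<open>k\<close> moves to degree \<open>k + 1\<close> with probability about
  \<open>(k + 1)/N\<close> (\<open>N\<close> is the number of vertices), to \<open>k - 1\<close> with probability about \<open>k/N\<close>, and to \<open>0\<close> with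
  probability about \<open>1/N\<close>, while the new vertex has degree \<open>k + 1\<close> with probability \<open>X_k/N\<close>. The
  corrections are of relative order \<open>1/N\<close>, because the expected sum of all degrees after \<open>n\<close> steps is
  only \<open>2 n\<close> (\<open>mean_degree_total\<close>). If an average \<open>a n / (n + 1)\<close> and the increments of \<open>a\<close> both
  converge, then the limits agree; bounded convergence therefore gives
  \<open>(2 d + 3) c_d = (d + 1) (c_{d-1} + c_{d+1})\<close> and \<open>3 c_0 = 1 + c_1\<close>
  (\<open>mean_count_limit_recurrence\<close>).

  The recurrence is solved by moments. Putting \<open>b_d = c_d / (d + 1) = \<integral> y^d \<phi>(y) dy\<close> over \<open>(0, 1)\<close> and
  integrating by parts, it becomes \<open>(1 - y)^2 \<phi>' = - \<phi>\<close>, so \<open>\<phi>(y) = exp (- 1 / (1 - y))\<close>. The boundary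
  term at \<open>y = 0\<close> together with \<open>3 c_0 = 1 + c_1\<close> fixes the factor \<open>e\<close> (\<open>weight_moment_recurrence\<close>).
  Every other solution with the same equation at \<open>0\<close> grows at least linearly, whereas
  \<open>0 \<le> c_d \<le> 1\<close>; hence \<open>c_d = e (d + 1) \<integral> y^d exp (- 1 / (1 - y)) dy\<close>.

  For the asymptotics, substitute \<open>y = exp (- x)\<close>. Since \<open>1 / (1 - exp (- x))\<close> lies between
  \<open>1 / x + 1 / 2\<close> and \<open>1 / x + 1 / 2 + x / 4\<close>, the moment is caught between \<open>e^(-1/2) I(d + 5/4)\<close> and
  \<open>e^(-1/2) I(d + 1)\<close>, where \<open>I(a) = \<integral> exp (- a x - 1 / x) dx\<close> is a Bessel integral. Completing the
  square in \<open>s = sqrt (a x) - 1 / sqrt x\<close> makes its integrand Gaussian, and quadratic bounds on the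
  Jacobian reduce it to the moments of orders 0, 1, 2 (\<open>bessel_integral_bounds\<close>). The result is
  \<open>I(a) \<sim> sqrt \<pi> a^(-3/4) exp (- 2 sqrt a)\<close>, and the constant of the theorem is
  \<open>e \<cdot> e^(-1/2) \<cdot> sqrt \<pi> = sqrt (e \<pi>)\<close>.
\<close>

section \<open>Degrees after one step\<close>

definition evolve :: "nat \<Rightarrow> nat set set \<Rightarrow> nat \<Rightarrow> nat \<Rightarrow> nat set set" where
  "evolve n E u v = delete_old_edges (duplicate E (Suc n) u) (Suc n) v"

definition simple_on :: "nat \<Rightarrow> nat set set \<Rightarrow> bool" where
  "simple_on n E \<longleftrightarrow> (\<forall>e\<in>E. e \<subseteq> {..n} \<and> card e = 2)"

lemma graph_edges_Suc_evolve:
  "graph_edges u v (Suc n) = evolve n (graph_edges u v n) (u n) (v n)"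
  by (simp add: evolve_def)

lemma neighbours_sym: "w \<in> neighbours E u \<longleftrightarrow> u \<in> neighbours E w"
  by (simp add: neighbours_def insert_commute)

lemma simple_on_neighbours:
  assumes "simple_on n E"
  shows "neighbours E w \<subseteq> {..n}" "w \<notin> neighbours E w" "finite (neighbours E w)"
proof -
  show 1: "neighbours E w \<subseteq> {..n}" using assms by (auto simp: simple_on_def neighbours_def)
  show "w \<notin> neighbours E w" using assms by (fastforce simp: simple_on_def neighbours_def)
  show "finite (neighbours E w)" using 1 finite_subset by blast
qed

lemma simple_on_edge:
  assumes "simple_on n E" "{a, b} \<in> E"
  shows "a \<le> n" "b \<le> n" "a \<noteq> b"
  using assms by (force simp: simple_on_def)+

lemma simple_on_evolve:
  assumes "simple_on n E" "u \<le> n"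
  shows "simple_on (Suc n) (evolve n E u v)"
proof -
  have "{Suc n, w} \<subseteq> {..Suc n} \<and> card {Suc n, w} = 2" if "w = u \<or> w \<in> neighbours E u" for w
  proof -
    have "w \<le> n" using that assms simple_on_neighbours(1)[OF assms(1), of u] by auto
    then show ?thesis by auto
  qed
  moreover have "e \<subseteq> {..Suc n} \<and> card e = 2" if "e \<in> E" for e
    using assms(1) that unfolding simple_on_def by fastforce
  ultimately show ?thesis
    by (auto simp: simple_on_def evolve_def delete_old_edges_def duplicate_def)
qed

lemma neighbours_evolve_new:
  assumes "simple_on n E" "u \<le> n"
  shows "neighbours (evolve n E u v) (Suc n) = insert u (neighbours E u)"
proof -
  have "{Suc n, w} \<notin> E" for w
    using simple_on_edge[OF assms(1)] by fastforce
  then show ?thesis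
    using assms(2) simple_on_neighbours(1)[OF assms(1), of u]
    by (auto simp: neighbours_def evolve_def delete_old_edges_def duplicate_def doubleton_eq_iff)
qed

text \<open>
  The edge from an old vertex to the new one survives the deletion, also when \<open>w = v\<close>; so the
  contributions of the two choices to the neighbourhood are disjoint.
\<close>

lemma neighbours_evolve_old:
  assumes E: "simple_on n E" and "u \<le> n" "v \<le> n" "w \<le> n"
  shows "neighbours (evolve n E u v) w =
    (if v = w then {} else neighbours E w - {v}) \<union> (if u \<in> insert w (neighbours E w) then {Suc n} else {})"
proof -
  have "x \<in> neighbours (evolve n E u v) w \<longleftrightarrow> 
     x \<in> (if v = w then {} else neighbours E w - {v}) \<union> (if u \<in> insert w (neighbours E w) then {Suc n} else {})" for x
  proof (cases "x = Suc n")
    case True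
    have "{w, Suc n} \<notin> E" "w \<noteq> Suc n" using simple_on_edge[OF E] assms(4) by fastforce+
    moreover have "Suc n \<notin> neighbours E w" using simple_on_neighbours(1)[OF E, of w] by auto
    ultimately show ?thesis using True neighbours_sym[of u E w]
      by (auto simp: neighbours_def evolve_def delete_old_edges_def duplicate_def doubleton_eq_iff)
  next
    case False
    then show ?thesis using assms
      by (auto simp: neighbours_def evolve_def delete_old_edges_def duplicate_def doubleton_eq_iff)
  qed
  then show ?thesis by blast
qed

lemma vertex_degree_evolve_new:
  assumes "simple_on n E" "u \<le> n"
  shows "vertex_degree (evolve n E u v) (Suc n) = Suc (vertex_degree E u)"
  using simple_on_neighbours[OF assms(1), of u]
  by (simp add: vertex_degree_def neighbours_evolve_new[OF assms])

lemma vertex_degree_evolve_old: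
  assumes E: "simple_on n E" and "u \<le> n" "v \<le> n" "w \<le> n"
  shows "vertex_degree (evolve n E u v) w =
    (if v = w then 0 else if v \<in> neighbours E w then vertex_degree E w - 1 else vertex_degree E w)
      + (if u \<in> insert w (neighbours E w) then 1 else 0)"
proof -
  have "Suc n \<notin> neighbours E w" "finite (neighbours E w)"
    using simple_on_neighbours[OF E, of w] by auto
  then show ?thesis
    unfolding vertex_degree_def neighbours_evolve_old[OF assms] by auto
qed

definition degree_sum :: "nat \<Rightarrow> (nat \<Rightarrow> real) \<Rightarrow> nat set set \<Rightarrow> real" where
  "degree_sum n f E = (\<Sum>w\<le>n. f (vertex_degree E w))"

text \<open>
  The total weight \<open>f\<close> that one vertex of degree \<open>k\<close> passes on when all \<open>N^2\<close> pairs of choices are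
  tried: \<open>N f(k + 1)\<close> is the contribution of the vertices born as copies of it, and the other two
  summands come from the vertex itself, according to whether \<open>u\<close> is one of the \<open>k + 1\<close> elements of
  its closed neighbourhood or not. Inside each of them the choices of \<open>v\<close> are the vertex itself, one
  of its \<open>k\<close> neighbours, or one of the \<open>N - 1 - k\<close> remaining vertices.
\<close>

definition degree_generator :: "real \<Rightarrow> (nat \<Rightarrow> real) \<Rightarrow> nat \<Rightarrow> real" where
  "degree_generator N f k = N * f (k + 1)
    + (real k + 1) * (f 1 + real k * f k + (N - 1 - real k) * f (k + 1))
    + (N - 1 - real k) * (f 0 + real k * f (k - 1) + (N - 1 - real k) * f k)"

lemma sum_mem_cases:
  fixes p q :: real
  assumes "finite A" "B \<subseteq> A"
  shows "(\<Sum>x\<in>A. if x \<in> B then p else q) = real (card B) * p + (real (card A) - real (card B)) * q"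
proof -
  have "A \<inter> {x. x \<in> B} = B" "A \<inter> - {x. x \<in> B} = A - B" using assms(2) by auto
  moreover have "card (A - B) = card A - card B" "card B \<le> card A"
    using assms by (auto simp: card_Diff_subset finite_subset card_mono)
  ultimately show ?thesis using assms(1) by (simp add: sum.If_cases of_nat_diff)
qed

lemma sum_choices_old_vertex:
  assumes E: "simple_on n E" and w: "w \<le> n"
  shows "(\<Sum>u\<le>n. \<Sum>v\<le>n. f (vertex_degree (evolve n E u v) w))
    = degree_generator (real n + 1) f (vertex_degree E w) - (real n + 1) * f (vertex_degree E w + 1)"
proof -
  define K where "K = neighbours E w"
  define k where "k = vertex_degree E w"
  have K: "finite K" "K \<subseteq> {..n}" "w \<notin> K" and cK: "card K = k"
    using simple_on_neighbours[OF E, of w] by (auto simp: K_def k_def vertex_degree_def)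
  \<comment> \<open>\<open>b\<close> is the degree gained from the duplication, so \<open>H b\<close> sums over \<open>v\<close> for given \<open>u\<close>.\<close>
  define H where "H b = (\<Sum>v\<le>n. f ((if v = w then 0 else if v \<in> K then k - 1 else k) + b))" for b
  have H: "H b = f b + real k * f (k - 1 + b) + (real n - real k) * f (k + b)" for b
  proof -
    have "H b = f b + (\<Sum>v\<in>{..n} - {w}. if v \<in> K then f (k - 1 + b) else f (k + b))"
    proof -
      have "H b = f b + (\<Sum>v\<in>{..n} - {w}. f ((if v = w then 0 else if v \<in> K then k - 1 else k) + b))"
        unfolding H_def using w by (subst sum.remove[of _ w]) auto
      also have "(\<Sum>v\<in>{..n} - {w}. f ((if v = w then 0 else if v \<in> K then k - 1 else k) + b))
          = (\<Sum>v\<in>{..n} - {w}. if v \<in> K then f (k - 1 + b) else f (k + b))"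
        by (rule sum.cong) simp_all
      finally show ?thesis .
    qed
    also have "(\<Sum>v\<in>{..n} - {w}. if v \<in> K then f (k - 1 + b) else f (k + b))
        = real k * f (k - 1 + b) + (real n - real k) * f (k + b)"
      by (subst sum_mem_cases) (use K cK w in auto)
    finally show ?thesis by simp
  qed
  have "(\<Sum>u\<le>n. \<Sum>v\<le>n. f (vertex_degree (evolve n E u v) w))
      = (\<Sum>u\<le>n. H (if u \<in> insert w K then 1 else 0))"
    unfolding H_def K_def k_def using w by (intro sum.cong refl) (simp add: vertex_degree_evolve_old[OF E])
  also have "\<dots> = (\<Sum>u\<le>n. if u \<in> insert w K then H 1 else H 0)"
    by (intro sum.cong) auto
  also have "\<dots> = (real k + 1) * H 1 + (real n - real k) * H 0"
    by (subst sum_mem_cases) (use K cK w in auto)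
  also have "real k * f (k - 1 + 1) = real k * f k" by (cases k) auto
  then have "(real k + 1) * H 1 + (real n - real k) * H 0 =
      degree_generator (real n + 1) f k - (real n + 1) * f (k + 1)"
    unfolding H degree_generator_def by simp
  finally show ?thesis by (simp add: k_def)
qed

text \<open>
  This closes the system: averages of degree functions after \<open>n + 1\<close> steps only depend on averages
  of degree functions after \<open>n\<close> steps, not on the finer structure of the graph.
\<close>

lemma sum_choices_degree_sum:
  assumes "simple_on n E"
  shows "(\<Sum>u\<le>n. \<Sum>v\<le>n. degree_sum (Suc n) f (evolve n E u v))
    = degree_sum n (degree_generator (real n + 1) f) E"
proof -
  have "(\<Sum>u\<le>n. \<Sum>v\<le>n. degree_sum (Suc n) f (evolve n E u v))
      = (\<Sum>u\<le>n. \<Sum>v\<le>n. \<Sum>w\<le>n. f (vertex_degree (evolve n E u v) w))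
        + (\<Sum>u\<le>n. \<Sum>v\<le>n. f (vertex_degree E u + 1))"
    by (simp add: degree_sum_def vertex_degree_evolve_new[OF assms] sum.distrib)
  also have "(\<Sum>u\<le>n. \<Sum>v\<le>n. \<Sum>w\<le>n. f (vertex_degree (evolve n E u v) w))
      = (\<Sum>w\<le>n. \<Sum>u\<le>n. \<Sum>v\<le>n. f (vertex_degree (evolve n E u v) w))"
  proof -
    have "(\<Sum>v\<le>n. \<Sum>w\<le>n. f (vertex_degree (evolve n E u v) w))
        = (\<Sum>w\<le>n. \<Sum>v\<le>n. f (vertex_degree (evolve n E u v) w))" for u
      by (rule sum.swap)
    then show ?thesis by (simp only:) (rule sum.swap[of _ "{..n}" "{..n}"])
  qed
  also have "\<dots> = (\<Sum>w\<le>n. degree_generator (real n + 1) f (vertex_degree E w)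
      - (real n + 1) * f (vertex_degree E w + 1))"
    by (intro sum.cong refl sum_choices_old_vertex assms) simp
  finally show ?thesis by (simp add: degree_sum_def sum_subtractf add_ac)
qed

section \<open>Averages over all choices\<close>

text \<open>
  The expectation of \<open>f\<close> over the random graph after \<open>n\<close> steps, as a finite average that makes no
  reference to the probability space.
\<close>

primrec graph_mean :: "nat \<Rightarrow> (nat set set \<Rightarrow> real) \<Rightarrow> real" where
  "graph_mean 0 f = f {}"
| "graph_mean (Suc n) f = (\<Sum>u\<le>n. \<Sum>v\<le>n. graph_mean n (\<lambda>E. f (evolve n E u v))) / (real n + 1)\<^sup>2"

lemma graph_mean_cong:
  "(\<And>E. simple_on n E \<Longrightarrow> f E = g E) \<Longrightarrow> graph_mean n f = graph_mean n g"
proof (induction n arbitrary: f g)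
  case 0
  then show ?case by (simp add: simple_on_def)
next
  case (Suc n)
  have "graph_mean n (\<lambda>E. f (evolve n E u v)) = graph_mean n (\<lambda>E. g (evolve n E u v))" if "u \<le> n" for u v
    by (intro Suc.IH Suc.prems simple_on_evolve that)
  then show ?case by simp
qed

lemma graph_mean_sum: "graph_mean n (\<lambda>E. \<Sum>i\<in>I. f i E) = (\<Sum>i\<in>I. graph_mean n (f i))"
proof (induction n arbitrary: f)
  case (Suc n)
  then show ?case
    by (simp add: sum_divide_distrib[symmetric] sum.swap[of _ I])
qed simp

lemma graph_mean_mult: "graph_mean n (\<lambda>E. a * f E) = a * graph_mean n f"
  by (induction n arbitrary: f) (simp_all add: sum_distrib_left)

lemma graph_mean_add: "graph_mean n (\<lambda>E. f E + g E) = graph_mean n f + graph_mean n g"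
  by (induction n arbitrary: f g) (simp_all add: sum.distrib add_divide_distrib)

lemma graph_mean_const: "graph_mean n (\<lambda>E. a) = a"
proof (induction n)
  case (Suc n)
  have "real n + 1 \<noteq> 0" by (simp add: add_nonneg_eq_0_iff)
  then show ?case by (simp add: Suc power2_eq_square add.commute)
qed simp

definition mean_degree_sum :: "nat \<Rightarrow> (nat \<Rightarrow> real) \<Rightarrow> real" where
  "mean_degree_sum n f = graph_mean n (degree_sum n f)"

lemma mean_degree_sum_Suc:
  "mean_degree_sum (Suc n) f = mean_degree_sum n (degree_generator (real n + 1) f) / (real n + 1)\<^sup>2"
proof -
  have "mean_degree_sum (Suc n) f =
      graph_mean n (\<lambda>E. \<Sum>u\<le>n. \<Sum>v\<le>n. degree_sum (Suc n) f (evolve n E u v)) / (real n + 1)\<^sup>2"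
    by (simp add: mean_degree_sum_def graph_mean_sum)
  also have "graph_mean n (\<lambda>E. \<Sum>u\<le>n. \<Sum>v\<le>n. degree_sum (Suc n) f (evolve n E u v))
      = mean_degree_sum n (degree_generator (real n + 1) f)"
    unfolding mean_degree_sum_def by (intro graph_mean_cong sum_choices_degree_sum)
  finally show ?thesis .
qed

lemma mean_degree_sum_linear:
  "mean_degree_sum n (\<lambda>k. a * f k + g k) = a * mean_degree_sum n f + mean_degree_sum n g"
  by (simp add: mean_degree_sum_def degree_sum_def[abs_def] sum.distrib graph_mean_add graph_mean_mult
      flip: sum_distrib_left)

lemma mean_degree_sum_const: "mean_degree_sum n (\<lambda>k. a) = (real n + 1) * a"
  by (simp add: mean_degree_sum_def degree_sum_def[abs_def] graph_mean_const)

text \<open>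
  A step creates \<open>deg u + 1\<close> edges and deletes \<open>deg v\<close> of them. As \<open>u\<close> and \<open>v\<close> have the same
  distribution, the expected number of edges increases by exactly 1.
\<close>

lemma mean_degree_total: "mean_degree_sum n real = 2 * real n"
proof (induction n)
  case 0
  then show ?case by (simp add: mean_degree_sum_def degree_sum_def vertex_degree_def neighbours_def)
next
  case (Suc n)
  define N where "N = real n + 1"
  have "N > 0" by (simp add: N_def add_nonneg_pos)
  have "degree_generator N real k = N\<^sup>2 * real k + 2 * N" for k
    by (cases k) (simp_all add: degree_generator_def algebra_simps power2_eq_square)
  then have "degree_generator N real = (\<lambda>k. N\<^sup>2 * real k + 2 * N)" by (rule ext)
  then have "mean_degree_sum (Suc n) real = (N\<^sup>2 * (2 * real n) + N * (2 * N)) / N\<^sup>2"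
    unfolding mean_degree_sum_Suc N_def[symmetric]
    by (simp only: mean_degree_sum_linear mean_degree_sum_const Suc N_def)
  also have "\<dots> = 2 * real n + 2" using \<open>N > 0\<close> by (simp add: field_simps power2_eq_square)
  finally show ?case by simp
qed

section \<open>The expected degree counts\<close>

definition mean_count :: "nat \<Rightarrow> nat \<Rightarrow> real" where
  "mean_count n d = mean_degree_sum n (indicator {d})"

text \<open>
  Everything is expressed through the proportions \<open>mean_count n j / N\<close>, because these converge; the
  last summand, divided by \<open>N\<close>, vanishes in the limit. Its term for \<open>d = 1\<close> belongs to the
  vertices that lose all old edges and keep the one to the new vertex.
\<close>

lemma mean_count_step:
  fixes n d
  defines "N \<equiv> real n + 1"
  assumes "d \<ge> 1"
  shows "mean_count (Suc n) d - mean_count n d =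
     (real d + 1) * (mean_count n (d - 1) / N + mean_count n (d + 1) / N - 2 * (mean_count n d / N))
   + ((if d = 1 then (2 * real n + N) / N else 0) + (real d + 1) * (2 * real d + 1) * (mean_count n d / N)
       - (real d)\<^sup>2 * (mean_count n (d - 1) / N)
       - (real d + 1) * (real d + 2) * (mean_count n (d + 1) / N)) / N"
proof -
  have "N > 0" by (simp add: N_def add_nonneg_pos)
  define o1 :: real where "o1 = (if d = 1 then 1 else 0)"
  \<comment> \<open>On the support of each indicator, \<open>k\<close> may be replaced by a constant; this makes the image of an
    indicator under the generator a linear combination of indicators, \<open>real\<close> and a constant.\<close>
  have "degree_generator N (indicator {d}) = (\<lambda>k.
      (N\<^sup>2 - 2 * N * (real d + 1) + (real d + 1) * (2 * real d + 1)) * indicator {d} k +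
      ((N * (real d + 1) - (real d)\<^sup>2) * indicator {d - 1} k +
      ((N * (real d + 1) - (real d + 1) * (real d + 2)) * indicator {d + 1} k +
      (o1 * real k + o1))))"
    using assms(2)
    by (auto simp: fun_eq_iff degree_generator_def o1_def indicator_def algebra_simps power2_eq_square of_nat_diff)
  then have "mean_count (Suc n) d =
     ((N\<^sup>2 - 2 * N * (real d + 1) + (real d + 1) * (2 * real d + 1)) * mean_count n d
     + ((N * (real d + 1) - (real d)\<^sup>2) * mean_count n (d - 1)
     + ((N * (real d + 1) - (real d + 1) * (real d + 2)) * mean_count n (d + 1)
     + (o1 * (2 * real n) + N * o1)))) / N\<^sup>2"
    unfolding mean_count_def mean_degree_sum_Suc N_def[symmetric]
    by (simp only: mean_degree_sum_linear mean_degree_total mean_degree_sum_const N_def)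
  moreover have "(if d = 1 then (2 * real n + N) / N else 0) = o1 * (2 * real n + N) / N"
    by (simp add: o1_def)
  ultimately show ?thesis
    using \<open>N > 0\<close> by (simp only:) (simp add: field_simps power2_eq_square)
qed

text \<open>
  The summand 1 stems from the vertices chosen for deletion: one in each step, and it becomes
  isolated unless it is joined to the new vertex.
\<close>

lemma mean_count_step_zero:
  fixes n
  defines "N \<equiv> real n + 1"
  shows "mean_count (Suc n) 0 - mean_count n 0 =
     1 + mean_count n 1 / N - 2 * (mean_count n 0 / N)
   + (mean_count n 0 / N - 2 * (mean_count n 1 / N) - (2 * real n + N) / N) / N"
proof -
  have "N > 0" by (simp add: N_def add_nonneg_pos)
  have "degree_generator N (indicator {0}) k =
      (N\<^sup>2 - 2 * N + 1) * indicator {0} k + ((N - 2) * indicator {1} k +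
      (- 1 * real k + (N - 1)))" for k
    by (cases "k = 0"; cases "k = 1")
      (auto simp: degree_generator_def indicator_def algebra_simps power2_eq_square)
  then have "degree_generator N (indicator {0}) = (\<lambda>k.
      (N\<^sup>2 - 2 * N + 1) * indicator {0} k + ((N - 2) * indicator {1} k +
      (- 1 * real k + (N - 1))))"
    by (rule ext)
  then have "mean_count (Suc n) 0 =
     ((N\<^sup>2 - 2 * N + 1) * mean_count n 0 + ((N - 2) * mean_count n 1
     + (- 1 * (2 * real n) + N * (N - 1)))) / N\<^sup>2"
    unfolding mean_count_def mean_degree_sum_Suc N_def[symmetric]
    by (simp only: mean_degree_sum_linear mean_degree_total mean_degree_sum_const N_def)
  then show ?thesis
    using \<open>N > 0\<close> by (simp only:) (simp add: field_simps power2_eq_square)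
qed

section \<open>The random graph\<close>

context duplication_deletion_process
begin

lemma choice_measurable: "case_sum U V i \<in> measurable M (count_space UNIV)"
  using indep_choices by (simp add: indep_vars_def)

lemma U_measurable: "U n \<in> measurable M (count_space UNIV)"
  and V_measurable: "V n \<in> measurable M (count_space UNIV)"
  using choice_measurable[of "Inl n"] choice_measurable[of "Inr n"] by simp_all

lemma prob_uniform_choice:
  assumes X: "X \<in> measurable M (count_space UNIV)"
    and distr: "distr M (count_space UNIV) X = measure_pmf (pmf_of_set {..n})" and "x \<le> n"
  shows "prob {\<omega> \<in> space M. X \<omega> = x} = 1 / (real n + 1)" "AE \<omega> in M. X \<omega> \<le> n"
proof -
  have "prob {\<omega> \<in> space M. X \<omega> = x} = measure (distr M (count_space UNIV) X) {x}"
    using X by (subst measure_distr) (auto intro!: arg_cong[where f = prob])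
  also have "\<dots> = 1 / (real n + 1)"
    using assms(3) unfolding distr by (simp add: measure_pmf_single add.commute)
  finally show "prob {\<omega> \<in> space M. X \<omega> = x} = 1 / (real n + 1)" .
  have "AE x in distr M (count_space UNIV) X. x \<le> n"
    unfolding distr by (simp add: AE_measure_pmf_iff)
  then show "AE \<omega> in M. X \<omega> \<le> n"
    using X by (subst (asm) AE_distr_iff) auto
qed

abbreviation graph :: "nat \<Rightarrow> 'w \<Rightarrow> nat set set" where
  "graph n \<omega> \<equiv> graph_edges (\<lambda>k. U k \<omega>) (\<lambda>k. V k \<omega>) n"

text \<open>
  The choices range over a countable type, the graphs do not; so measurability is obtained by
  fixing the choices of one step at a time.
\<close>

lemma graph_measurable: "graph n \<in> measurable M (count_space UNIV)"
proof (induction n)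
  case (Suc n)
  have 1: "(\<lambda>\<omega>. evolve n (graph n \<omega>) u v) \<in> measurable M (count_space UNIV)" for u v
    by (rule measurable_compose[OF Suc]) simp
  have "(\<lambda>\<omega>. evolve n (graph n \<omega>) u (V n \<omega>)) \<in> measurable M (count_space UNIV)" for u
    using measurable_compose_countable[OF 1 V_measurable] .
  from measurable_compose_countable[OF this U_measurable]
  show ?case by (simp only: graph_edges_Suc_evolve)
qed simp

text \<open>
  The product of indicators of choices made at step \<open>n\<close> or later carries the independence of the
  future from the graph through the induction: splitting the graph after \<open>n + 1\<close> steps by the values
  of \<open>U n\<close> and \<open>V n\<close> merely adds two factors to this product. In the base case the graph is constant
  and the product rule for independent variables applies.
\<close>

lemma graph_mean_choices:
  fixes f :: "nat set set \<Rightarrow> real"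
  assumes "finite J" "\<And>i. i \<in> J \<Longrightarrow> n \<le> case_sum id id i"
  shows "has_bochner_integral M
    (\<lambda>\<omega>. f (graph n \<omega>) * (\<Prod>i\<in>J. indicator {b i} (case_sum U V i \<omega>)))
    (graph_mean n f * (\<Prod>i\<in>J. prob {\<omega> \<in> space M. case_sum U V i \<omega> = b i}))"
  using assms
proof (induction n arbitrary: f b J)
  case 0
  define Y :: "nat + nat \<Rightarrow> 'w \<Rightarrow> real" where "Y i \<omega> = indicator {b i} (case_sum U V i \<omega>)" for i \<omega>
  have meas: "Y i \<in> borel_measurable M" for i
    unfolding Y_def by (rule measurable_compose[OF choice_measurable]) simp
  have "indep_vars (\<lambda>_. borel) Y UNIV"
    unfolding Y_def by (rule indep_vars_compose2[OF indep_choices]) simp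
  then have indep: "indep_vars (\<lambda>_. borel) Y J" by (rule indep_vars_subset) simp
  have int: "integrable M (Y i)" for i
    by (rule integrable_const_bound[of _ 1]) (auto simp: Y_def meas split: split_indicator)
  have "expectation (Y i) = prob {\<omega> \<in> space M. case_sum U V i \<omega> = b i}" for i
  proof -
    have "expectation (Y i) = expectation (indicator {\<omega> \<in> space M. case_sum U V i \<omega> = b i})"
      by (rule Bochner_Integration.integral_cong) (auto simp: Y_def indicator_def)
    also have "\<dots> = prob {\<omega> \<in> space M. case_sum U V i \<omega> = b i}"
      by (simp add: Int_absorb2 Collect_restrict)
    finally show ?thesis .
  qed
  then have "has_bochner_integral M (\<lambda>\<omega>. \<Prod>i\<in>J. Y i \<omega>)
      (\<Prod>i\<in>J. prob {\<omega> \<in> space M. case_sum U V i \<omega> = b i})"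
    using indep_vars_integrable[OF 0(1) indep int] indep_vars_lebesgue_integral[OF 0(1) indep int]
    by (simp add: has_bochner_integral_iff)
  then show ?case by (simp add: Y_def has_bochner_integral_mult_right)
next
  case (Suc n)
  define I where "I b J \<omega> = (\<Prod>i\<in>J. indicator {b i} (case_sum U V i \<omega>) :: real)" for b J \<omega>
  define P where "P b J = (\<Prod>i\<in>J. prob {\<omega> \<in> space M. case_sum U V i \<omega> = b i})" for b J
  define J' where "J' = insert (Inl n) (insert (Inr n) J)"
  define b' where "b' u v = b(Inl n := u, Inr n := v)" for u v
  have notin: "Inl n \<notin> J" "Inr n \<notin> J" using Suc.prems(2) by fastforce+
  have Ib: "I (b' u v) J = I b J" "P (b' u v) J = P b J" for u v
    unfolding I_def P_def b'_def using notin by (auto intro!: ext prod.cong)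
  have I': "I (b' u v) J' \<omega> = indicator {u} (U n \<omega>) * (indicator {v} (V n \<omega>) * I b J \<omega>)" for u v \<omega>
    unfolding Ib[of u v, symmetric] unfolding I_def J'_def using notin Suc.prems(1) by (simp add: b'_def)
  have P': "P (b' u v) J' = 1 / (real n + 1) * (1 / (real n + 1) * P b J)" if "u \<le> n" "v \<le> n" for u v
    unfolding Ib[of u v, symmetric] unfolding P_def J'_def using notin Suc.prems(1)
    by (simp add: b'_def prob_uniform_choice(1)[OF U_measurable U_uniform that(1)]
        prob_uniform_choice(1)[OF V_measurable V_uniform that(2)])
  have "has_bochner_integral M (\<lambda>\<omega>. \<Sum>u\<le>n. \<Sum>v\<le>n. f (evolve n (graph n \<omega>) u v) * I (b' u v) J' \<omega>)
     (\<Sum>u\<le>n. \<Sum>v\<le>n. graph_mean n (\<lambda>E. f (evolve n E u v)) * P (b' u v) J')"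
    unfolding I_def P_def
    by (intro has_bochner_integral_sum Suc.IH) (use Suc.prems in \<open>auto simp: J'_def dest: Suc_leD\<close>)
  also have "(\<Sum>u\<le>n. \<Sum>v\<le>n. graph_mean n (\<lambda>E. f (evolve n E u v)) * P (b' u v) J')
      = graph_mean (Suc n) f * P b J"
    by (simp add: P' sum_distrib_right sum_divide_distrib power2_eq_square)
  finally have "has_bochner_integral M (\<lambda>\<omega>. f (graph (Suc n) \<omega>) * I b J \<omega>) (graph_mean (Suc n) f * P b J)"
  proof (rule has_bochner_integralI_AE)
    have "(\<lambda>\<omega>. f (graph (Suc n) \<omega>)) \<in> borel_measurable M"
      by (rule measurable_compose[OF graph_measurable]) simp
    moreover have "I b J \<in> borel_measurable M"
      unfolding I_def by (intro borel_measurable_prod measurable_compose[OF choice_measurable]) simp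
    ultimately show "(\<lambda>\<omega>. f (graph (Suc n) \<omega>) * I b J \<omega>) \<in> borel_measurable M"
      by (rule borel_measurable_times)
    have "AE \<omega> in M. U n \<omega> \<le> n" "AE \<omega> in M. V n \<omega> \<le> n"
      using prob_uniform_choice(2)[OF U_measurable U_uniform, of 0]
        prob_uniform_choice(2)[OF V_measurable V_uniform, of 0] by auto
    then show "AE \<omega> in M. (\<Sum>u\<le>n. \<Sum>v\<le>n. f (evolve n (graph n \<omega>) u v) * I (b' u v) J' \<omega>)
        = f (graph (Suc n) \<omega>) * I b J \<omega>"
    proof eventually_elim
      case (elim \<omega>)
      have "f (evolve n (graph n \<omega>) u v) * I (b' u v) J' \<omega>
          = (if v = V n \<omega> then if u = U n \<omega> then f (evolve n (graph n \<omega>) u v) * I b J \<omega> else 0 else 0)" for u v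
        by (simp add: I')
      then have "(\<Sum>u\<le>n. \<Sum>v\<le>n. f (evolve n (graph n \<omega>) u v) * I (b' u v) J' \<omega>)
          = (\<Sum>u\<le>n. if u = U n \<omega> then f (evolve n (graph n \<omega>) u (V n \<omega>)) * I b J \<omega> else 0)"
        using elim by simp
      also have "\<dots> = f (evolve n (graph n \<omega>) (U n \<omega>) (V n \<omega>)) * I b J \<omega>"
        using elim by simp
      finally show ?case by (simp only: graph_edges_Suc_evolve)
    qed
  qed
  then show ?case by (simp only: I_def P_def)
qed

lemma has_bochner_integral_degree_count:
  "has_bochner_integral M (\<lambda>\<omega>. real (degree_count (\<lambda>k. U k \<omega>) (\<lambda>k. V k \<omega>) n d)) (mean_count n d)"
proof -
  have "real (degree_count (\<lambda>k. U k \<omega>) (\<lambda>k. V k \<omega>) n d) = degree_sum n (indicator {d}) (graph n \<omega>)" for \<omega>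
  proof -
    have "{w \<in> {..n}. vertex_degree (graph n \<omega>) w = d} = {..n} \<inter> {w. vertex_degree (graph n \<omega>) w = d}"
      by auto
    then show ?thesis
      by (simp add: degree_count_def degree_sum_def indicator_def of_bool_def sum.If_cases)
  qed
  then show ?thesis
    using graph_mean_choices[of "{}" n "degree_sum n (indicator {d})"]
    by (simp add: mean_count_def mean_degree_sum_def)
qed

end

section \<open>The recurrence for the limit proportions\<close>

text \<open>
  If the increments were eventually below some number less than \<open>l\<close>, the sequence would grow too
  slowly for the average \<open>l\<close>; applying this to \<open>- a\<close> gives the other inequality.
\<close>

lemma limit_average_eq_limit_increment:
  fixes a :: "nat \<Rightarrow> real"
  assumes avg: "(\<lambda>n. a n / (real n + 1)) \<longlonglongrightarrow> l" and incr: "(\<lambda>n. a (Suc n) - a n) \<longlonglongrightarrow> R"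
  shows "l = R"
proof -
  have upper: "L \<le> S" if avg: "(\<lambda>n. b n / (real n + 1)) \<longlonglongrightarrow> L"
    and incr: "(\<lambda>n. b (Suc n) - b n) \<longlonglongrightarrow> S" for b :: "nat \<Rightarrow> real" and L S
  proof (rule field_le_epsilon)
    fix e :: real assume "e > 0"
    then have "\<forall>\<^sub>F n in sequentially. b (Suc n) - b n < S + e"
      using order_tendstoD(2)[OF incr] by simp
    then obtain m where m: "\<And>n. n \<ge> m \<Longrightarrow> b (Suc n) - b n < S + e"
      by (auto simp: eventually_sequentially)
    have le: "b n \<le> (S + e) * (real n - real m) + b m" if "n \<ge> m" for n
      using that
    proof (induction n rule: dec_induct)
      case (step n)
      then show ?case using m[of n] by (simp add: algebra_simps)
    qed simp
    have "(\<lambda>n. ((S + e) * (real n - real m) + b m) / (real n + 1)) \<longlonglongrightarrow> S + e" by real_asymp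
    from LIMSEQ_le[OF avg this] show "L \<le> S + e"
      using le by (meson divide_right_mono of_nat_0_le_iff add_nonneg_nonneg zero_le_one)
  qed
  have "- l \<le> - R"
    by (rule upper[of "\<lambda>n. - a n"]) (use tendsto_minus[OF avg] tendsto_minus[OF incr] in simp_all)
  then show ?thesis using upper[OF avg incr] by linarith
qed

lemma mean_count_limit_recurrence:
  assumes lim: "\<And>d. (\<lambda>n. mean_count n d / (real n + 1)) \<longlonglongrightarrow> c d"
  shows "3 * c 0 = 1 + c 1"
    and "d \<ge> 1 \<Longrightarrow> (2 * real d + 3) * c d = (real d + 1) * (c (d - 1) + c (d + 1))"
proof -
  have inv: "(\<lambda>n. X n / (real n + 1)) \<longlonglongrightarrow> 0" if "X \<longlonglongrightarrow> L" for X :: "nat \<Rightarrow> real" and L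
  proof -
    have "(\<lambda>n. 1 / (real n + 1)) \<longlonglongrightarrow> 0" by real_asymp
    from tendsto_mult[OF that this] show ?thesis by simp
  qed
  have edges: "(\<lambda>n. (2 * real n + (real n + 1)) / (real n + 1)) \<longlonglongrightarrow> 3" by real_asymp
  have "(\<lambda>n. mean_count (Suc n) 0 - mean_count n 0) \<longlonglongrightarrow> 1 + c 1 - 2 * c 0 + 0"
    unfolding mean_count_step_zero
    by (intro tendsto_add tendsto_diff tendsto_mult tendsto_const lim
        inv[OF tendsto_diff[OF tendsto_diff[OF lim tendsto_mult[OF tendsto_const lim]] edges]])
  from limit_average_eq_limit_increment[OF lim this] show "3 * c 0 = 1 + c 1" by simp
  assume d: "d \<ge> 1"
  have edges': "(\<lambda>n. if d = 1 then (2 * real n + (real n + 1)) / (real n + 1) else 0)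
      \<longlonglongrightarrow> (if d = 1 then 3 else 0)"
    using edges by simp
  have "(\<lambda>n. mean_count (Suc n) d - mean_count n d) \<longlonglongrightarrow>
      (real d + 1) * (c (d - 1) + c (d + 1) - 2 * c d) + 0"
    unfolding mean_count_step[OF d]
    by (intro tendsto_add tendsto_diff tendsto_mult tendsto_const lim
      inv[OF tendsto_diff[OF tendsto_diff[OF tendsto_add[OF edges' tendsto_mult[OF tendsto_const lim]]
        tendsto_mult[OF tendsto_const lim]] tendsto_mult[OF tendsto_const lim]]])
  from limit_average_eq_limit_increment[OF lim this]
  show "(2 * real d + 3) * c d = (real d + 1) * (c (d - 1) + c (d + 1))"
    by (simp add: algebra_simps)
qed

lemma degree_count_le: "degree_count u v n d \<le> n + 1"
proof -
  have "degree_count u v n d \<le> card {..n}" unfolding degree_count_def by (rule card_mono) auto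
  then show ?thesis by simp
qed

lemma (in duplication_deletion_process) mean_count_tendsto:
  assumes lim: "AE \<omega> in M.
      (\<lambda>n. real (degree_count (\<lambda>k. U k \<omega>) (\<lambda>k. V k \<omega>) n d) / real (n + 1)) \<longlonglongrightarrow> c"
  shows "(\<lambda>n. mean_count n d / (real n + 1)) \<longlonglongrightarrow> c" "0 \<le> c" "c \<le> 1"
proof -
  define X where "X n \<omega> = real (degree_count (\<lambda>k. U k \<omega>) (\<lambda>k. V k \<omega>) n d) / (real n + 1)" for n \<omega>
  have X: "has_bochner_integral M (X n) (mean_count n d / (real n + 1))" for n
    unfolding X_def by (intro has_bochner_integral_divide_zero has_bochner_integral_degree_count)
  have bd: "0 \<le> X n \<omega>" "X n \<omega> \<le> 1" for n \<omega>
    using degree_count_le[of "\<lambda>k. U k \<omega>" "\<lambda>k. V k \<omega>" n d] by (auto simp: X_def divide_le_eq_1)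
  have lim': "AE \<omega> in M. (\<lambda>n. X n \<omega>) \<longlonglongrightarrow> c"
    using lim by (simp add: X_def add.commute)
  have "(\<lambda>n. expectation (X n)) \<longlonglongrightarrow> expectation (\<lambda>_. c)"
    by (rule integral_dominated_convergence[where w = "\<lambda>_. 1"])
      (use X lim' bd in \<open>auto simp: has_bochner_integral_iff\<close>)
  moreover have "expectation (X n) = mean_count n d / (real n + 1)" for n
    using X by (simp add: has_bochner_integral_iff)
  ultimately show "(\<lambda>n. mean_count n d / (real n + 1)) \<longlonglongrightarrow> c" by (simp add: prob_space)
  obtain \<omega> where \<omega>: "(\<lambda>n. X n \<omega>) \<longlonglongrightarrow> c"
    using AE_False lim' by (metis (mono_tags, lifting) eventually_mono)
  show "0 \<le> c" "c \<le> 1"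
    using LIMSEQ_le_const[OF \<omega>, of 0] LIMSEQ_le_const2[OF \<omega>, of 1] bd by auto
qed

section \<open>Uniqueness of the bounded solution\<close>

text \<open>
  The recurrence says that \<open>e (d + 1) - e d\<close> exceeds \<open>e d - e (d - 1)\<close> by \<open>e d / (d + 1)\<close>. So a solution
  that starts out positive and increasing is convex, and lies above its initial tangent.
\<close>

lemma recurrence_solution_unbounded:
  fixes e :: "nat \<Rightarrow> real"
  assumes "e 1 = 3 * e 0"
    and rec: "\<And>d. d \<ge> 1 \<Longrightarrow> (2 * real d + 3) * e d = (real d + 1) * (e (d - 1) + e (d + 1))"
    and "e 0 > 0"
  shows "e d \<ge> (2 * real d + 1) * e 0"
proof -
  have "e (Suc d) - e d \<ge> 2 * e 0 \<and> e d \<ge> (2 * real d + 1) * e 0" for d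
  proof (induction d)
    case (Suc d)
    have pos: "e (Suc d) \<ge> (2 * real (Suc d) + 1) * e 0"
      using Suc by (simp add: algebra_simps)
    moreover have "(2 * real (Suc d) + 1) * e 0 \<ge> 0" using assms by simp
    ultimately have "e (Suc d) \<ge> 0" by linarith
    have "(2 * real d + 5) * e (Suc d) = (real d + 2) * (e d + e (Suc (Suc d)))"
      using rec[of "Suc d"] by (simp add: algebra_simps)
    then have "(real d + 2) * (e (Suc (Suc d)) - e (Suc d) - (e (Suc d) - e d)) = e (Suc d)"
      by (simp add: algebra_simps)
    then have "e (Suc (Suc d)) - e (Suc d) - (e (Suc d) - e d) \<ge> 0"
      using \<open>e (Suc d) \<ge> 0\<close>
      by (metis add_nonneg_pos mult_less_0_iff not_less of_nat_0_le_iff zero_less_numeral)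
    with pos Suc show ?case by simp
  qed (use assms in auto)
  then show ?thesis by blast
qed

text \<open>
  The difference of two solutions satisfies the homogeneous equation \<open>e 1 = 3 * e 0\<close>, and it would be
  unbounded, up to sign, unless it vanishes at 0.
\<close>

lemma bounded_recurrence_solution_unique:
  fixes c c' :: "nat \<Rightarrow> real"
  assumes "3 * c 0 = 1 + c 1" "3 * c' 0 = 1 + c' 1"
    and rec: "\<And>d. d \<ge> 1 \<Longrightarrow> (2 * real d + 3) * c d = (real d + 1) * (c (d - 1) + c (d + 1))"
    and rec': "\<And>d. d \<ge> 1 \<Longrightarrow> (2 * real d + 3) * c' d = (real d + 1) * (c' (d - 1) + c' (d + 1))"
    and bd: "\<And>d. \<bar>c d\<bar> \<le> B" "\<And>d. \<bar>c' d\<bar> \<le> B"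
  shows "c = c'"
proof -
  have unbounded: "\<not> e 0 > 0"
    if e: "e 1 = 3 * e 0" "\<And>d. \<bar>e d\<bar> \<le> 2 * B"
      "\<And>d. d \<ge> 1 \<Longrightarrow> (2 * real d + 3) * e d = (real d + 1) * (e (d - 1) + e (d + 1))"
    for e :: "nat \<Rightarrow> real"
  proof
    assume "e 0 > 0"
    obtain d :: nat where "real d > 2 * B / e 0" using reals_Archimedean2 by blast
    then have "real d * e 0 > 2 * B" using \<open>e 0 > 0\<close> by (simp add: field_simps)
    moreover have "e d \<ge> (2 * real d + 1) * e 0"
      using recurrence_solution_unbounded[of e d] e \<open>e 0 > 0\<close> by blast
    moreover have "(2 * real d + 1) * e 0 \<ge> real d * e 0"
      using \<open>e 0 > 0\<close> by (intro mult_right_mono) auto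
    moreover have "e d \<le> 2 * B" using e(2)[of d] by linarith
    ultimately show False by linarith
  qed
  have "\<bar>c d - c' d\<bar> \<le> 2 * B" for d using bd[of d] by linarith
  then have "\<not> c 0 - c' 0 > 0" "\<not> c' 0 - c 0 > 0"
    using assms(1,2)
    by (intro unbounded[of "\<lambda>d. c d - c' d"] unbounded[of "\<lambda>d. c' d - c d"];
        simp add: right_diff_distrib rec rec' abs_minus_commute; simp add: algebra_simps)+
  then have zero: "c 0 = c' 0" by simp
  have "c d = c' d \<and> c (Suc d) = c' (Suc d)" for d
  proof (induction d)
    case (Suc d)
    have "(real d + 2) * c (Suc (Suc d)) = (real d + 2) * c' (Suc (Suc d))"
      using rec[of "Suc d"] rec'[of "Suc d"] Suc by (simp add: algebra_simps)
    with Suc show ?case by simp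
  qed (use zero assms in auto)
  then show ?thesis by auto
qed

section \<open>The Bessel integral\<close>

lemma gaussian_quadratic:
  fixes \<alpha> \<beta> :: real
  defines "f \<equiv> (\<lambda>s. exp (- s\<^sup>2) * (1 + \<alpha> * s + \<beta> * s\<^sup>2))"
  shows "f absolutely_integrable_on UNIV" "integral UNIV f = sqrt pi * (1 + \<beta> / 2)"
proof -
  have 0: "has_bochner_integral lborel (\<lambda>s::real. exp (- s\<^sup>2)) (2 * (sqrt pi / 2))"
    using has_bochner_integral_even_function[OF gaussian_moment_0] by simp
  have 1: "has_bochner_integral lborel (\<lambda>s::real. exp (- s\<^sup>2) * s) 0"
    using has_bochner_integral_odd_function[OF gaussian_moment_1] by simp
  have 2: "has_bochner_integral lborel (\<lambda>s::real. exp (- s\<^sup>2) * s\<^sup>2) (2 * (sqrt pi / 4))"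
    using has_bochner_integral_even_function[OF gaussian_moment_even_pos[of 1]] by simp
  have "has_bochner_integral lborel f (2 * (sqrt pi / 2) + \<alpha> * 0 + \<beta> * (2 * (sqrt pi / 4)))"
    using has_bochner_integral_add[OF has_bochner_integral_add[OF 0
        has_bochner_integral_mult_right[OF 1, of \<alpha>]] has_bochner_integral_mult_right[OF 2, of \<beta>]]
    by (simp add: f_def algebra_simps)
  then have f: "has_bochner_integral lborel f (sqrt pi * (1 + \<beta> / 2))"
    by (simp add: algebra_simps)
  then have int: "integrable lborel f" by (simp add: has_bochner_integral_iff)
  then show "f absolutely_integrable_on UNIV"
    by (simp add: set_integrable_def integrable_completion borel_measurable_integrable)
  show "integral UNIV f = sqrt pi * (1 + \<beta> / 2)"
    using integral_lborel[OF int] f by (simp add: has_bochner_integral_iff)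
qed

text \<open>
  In terms of the modified Bessel function \<open>K_1\<close> this is \<open>2 K_1(2 sqrt a) / sqrt a\<close>.
\<close>

definition bessel_integral :: "real \<Rightarrow> real" where
  "bessel_integral a = integral {0<..} (\<lambda>x. exp (- (a * x) - 1 / x))"

text \<open>
  With \<open>a = q^4\<close>, the substitution \<open>s = \<sigma> x\<close> completes the square:
  \<open>a x + 1 / x = s^2 + 2 q^2\<close>.
\<close>

lemma sqrt_difference_substitution:
  fixes q :: real
  assumes "q > 0"
  defines "\<sigma> \<equiv> (\<lambda>x. q\<^sup>2 * sqrt x - 1 / sqrt x)"
  defines "\<sigma>' \<equiv> (\<lambda>x. (q\<^sup>2 / sqrt x + 1 / (x * sqrt x)) / 2)"
  shows "x > 0 \<Longrightarrow> (\<sigma> has_field_derivative \<sigma>' x) (at x within S)"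
    and "inj_on \<sigma> {0<..}" and "\<sigma> ` {0<..} = UNIV"
proof -
  show "(\<sigma> has_field_derivative \<sigma>' x) (at x within S)" if "x > 0" for x S
    unfolding \<sigma>_def \<sigma>'_def using that
    by (auto intro!: derivative_eq_intros simp: field_simps)
  show "inj_on \<sigma> {0<..}"
  proof (rule linorder_inj_onI')
    fix x y :: real assume xy: "x \<in> {0<..}" "y \<in> {0<..}" "x < y"
    then have "q\<^sup>2 * sqrt x < q\<^sup>2 * sqrt y" "1 / sqrt y < 1 / sqrt x"
      using assms by (auto intro!: divide_strict_left_mono mult_pos_pos)
    then show "\<sigma> x \<noteq> \<sigma> y" by (simp add: \<sigma>_def)
  qed
  have "s \<in> \<sigma> ` {0<..}" for s
  proof
    \<comment> \<open>\<open>r = sqrt x\<close> is the positive root of \<open>q^2 r^2 - s r - 1 = 0\<close>.\<close>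
    define D where "D = sqrt (s\<^sup>2 + 4 * q\<^sup>2)"
    define r where "r = (s + D) / (2 * q\<^sup>2)"
    have D2: "D\<^sup>2 = s\<^sup>2 + 4 * q\<^sup>2" by (simp add: D_def)
    have "\<bar>s\<bar> < D" unfolding D_def using assms by (intro real_less_rsqrt) auto
    then have r: "r > 0" unfolding r_def using assms by (intro divide_pos_pos) auto
    have "s * (2 * q\<^sup>2 * r) = q\<^sup>2 * r * (2 * q\<^sup>2 * r) - 2 * q\<^sup>2"
    proof -
      have t: "2 * q\<^sup>2 * r = s + D" using assms by (simp add: r_def)
      have "q\<^sup>2 * r * (2 * q\<^sup>2 * r) = (s + D) * (s + D) / 2" by (simp flip: t)
      then show ?thesis unfolding t using D2 by (simp add: field_simps power2_eq_square)
    qed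
    then have "2 * q\<^sup>2 * (s * r) = 2 * q\<^sup>2 * (q\<^sup>2 * r * r - 1)"
      by (simp add: algebra_simps)
    then have "s * r = q\<^sup>2 * r * r - 1" using assms by simp
    then show "s = \<sigma> (r\<^sup>2)" using r by (simp add: \<sigma>_def field_simps)
    show "r\<^sup>2 \<in> {0<..}" using r by simp
  qed
  then show "\<sigma> ` {0<..} = UNIV" by auto
qed

text \<open>
  In the variable \<open>s = r - 1 / r\<close> the function \<open>2 r^3 / (r^2 + 1)\<close>, which is the reciprocal Jacobian up
  to scaling, touches the line \<open>1 + s\<close> at \<open>s = 0\<close>. In each bound the difference of the two sides has
  the factor \<open>(r - 1)^2\<close>.
\<close>

lemma jacobian_quadratic_bounds:
  fixes r :: real
  assumes "r > 0"
  defines "s \<equiv> r - 1 / r"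
  shows "1 + s \<le> 2 * r ^ 3 / (r\<^sup>2 + 1)" "2 * r ^ 3 / (r\<^sup>2 + 1) \<le> 1 + s + s\<^sup>2 / 2"
proof -
  have pos: "r\<^sup>2 + 1 > 0" by (simp add: add_nonneg_pos)
  have "2 * r ^ 3 / (r\<^sup>2 + 1) - (1 + s) = ((r - 1)\<^sup>2 * (r\<^sup>2 + r + 1)) / (r * (r\<^sup>2 + 1))"
    using assms pos by (simp add: s_def divide_simps) (simp add: algebra_simps power2_eq_square power3_eq_cube)
  also have "\<dots> \<ge> 0" using assms by (intro divide_nonneg_pos mult_nonneg_nonneg mult_pos_pos) (auto simp: add_nonneg_pos)
  finally show "1 + s \<le> 2 * r ^ 3 / (r\<^sup>2 + 1)" by simp
  have "1 + s + s\<^sup>2 / 2 - 2 * r ^ 3 / (r\<^sup>2 + 1) = ((r - 1)\<^sup>2 * (r ^ 4 + 1)) / (2 * r\<^sup>2 * (r\<^sup>2 + 1))"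
    using assms pos by (simp add: s_def divide_simps) (simp add: algebra_simps power2_eq_square power3_eq_cube power4_eq_xxxx)
  also have "\<dots> \<ge> 0" by (intro divide_nonneg_pos mult_nonneg_nonneg mult_pos_pos) (use assms in \<open>auto simp: add_nonneg_pos\<close>)
  finally show "2 * r ^ 3 / (r\<^sup>2 + 1) \<le> 1 + s + s\<^sup>2 / 2" by simp
qed

text \<open>
  The integrand is \<open>exp (- 2 q^2) exp (- (\<sigma> x)^2)\<close>. The substitution needs the factor \<open>\<sigma>' x\<close>, so 1 is
  written as \<open>\<sigma>'\<close> times its reciprocal, and the latter is replaced by polynomials in \<open>\<sigma>\<close>. The linear
  term integrates to zero, which leaves the relative error \<open>1 / (4 q^2)\<close> of the quadratic term.
\<close>

lemma bessel_integral_bounds: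
  fixes q :: real
  assumes "q > 0"
  shows "(\<lambda>x. exp (- (q ^ 4 * x) - 1 / x)) absolutely_integrable_on {0<..}"
    and "sqrt pi * exp (- 2 * q\<^sup>2) / q ^ 3 \<le> bessel_integral (q ^ 4)"
    and "bessel_integral (q ^ 4) \<le> sqrt pi * exp (- 2 * q\<^sup>2) / q ^ 3 * (1 + 1 / (4 * q\<^sup>2))"
proof -
  define \<sigma> where "\<sigma> = (\<lambda>x. q\<^sup>2 * sqrt x - 1 / sqrt x)"
  define \<sigma>' where "\<sigma>' = (\<lambda>x. (q\<^sup>2 / sqrt x + 1 / (x * sqrt x)) / 2)"
  define E where "E = exp (- 2 * q\<^sup>2) / q ^ 3"
  define f where "f = (\<lambda>x. exp (- (q ^ 4 * x) - 1 / x))"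
  define h where "h \<beta> s = exp (- s\<^sup>2) * (1 + 1 / q * s + \<beta> / q\<^sup>2 * s\<^sup>2)" for \<beta> s
  define k where "k \<beta> x = \<bar>\<sigma>' x\<bar> * h \<beta> (\<sigma> x)" for \<beta> x
  have "E > 0" using assms by (simp add: E_def)
  have k: "k \<beta> absolutely_integrable_on {0<..} \<and>
      integral {0<..} (k \<beta>) = sqrt pi * (1 + \<beta> / q\<^sup>2 / 2)" for \<beta>
  proof -
    note sub = sqrt_difference_substitution[OF assms, folded \<sigma>_def \<sigma>'_def]
    have "h \<beta> absolutely_integrable_on \<sigma> ` {0<..} \<and>
        integral (\<sigma> ` {0<..}) (h \<beta>) = sqrt pi * (1 + \<beta> / q\<^sup>2 / 2)"
      using gaussian_quadratic[of "1 / q" "\<beta> / q\<^sup>2"] by (simp add: sub(3) h_def[abs_def])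
    then show ?thesis
      unfolding k_def
      by (subst has_absolute_integral_change_of_variables_1'[where g = \<sigma> and f = "h \<beta>"])
        (use sub(1,2) in \<open>auto simp: \<sigma>'_def\<close>)
  qed
  have bounds: "E * k 0 x \<le> f x \<and> f x \<le> E * k (1 / 2) x" if x: "x \<in> {0<..}" for x
  proof -
    \<comment> \<open>The rescaling \<open>r = q sqrt x\<close> gives \<open>\<sigma> x = q (r - 1 / r)\<close> and removes \<open>q\<close> from the Jacobian bounds.\<close>
    define r where "r = q * sqrt x"
    have r: "r > 0" "sqrt x = r / q" "x = r\<^sup>2 / q\<^sup>2"
      using x assms by (auto simp: r_def power_mult_distrib)
    have \<sigma>: "\<sigma> x = q * (r - 1 / r)"
      unfolding \<sigma>_def r(2) using r(1) assms by (simp add: field_simps power2_eq_square)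
    have "\<sigma>' x = q ^ 3 / (2 * r ^ 3 / (r\<^sup>2 + 1))"
    proof -
      have "r\<^sup>2 + 1 \<noteq> 0" by (metis add_nonneg_pos less_irrefl zero_le_power2 zero_less_one)
      then show ?thesis
        unfolding \<sigma>'_def r(2) using r(1) assms by (subst r(3)) (simp add: field_simps power2_eq_square power3_eq_cube)
    qed
    then have J: "\<bar>\<sigma>' x\<bar> = q ^ 3 / (2 * r ^ 3 / (r\<^sup>2 + 1))"
      using r(1) assms by (simp add: add_nonneg_pos)
    have g: "2 * r ^ 3 / (r\<^sup>2 + 1) > 0" using r(1) by (simp add: add_nonneg_pos)
    have f: "f x = exp (- 2 * q\<^sup>2) * exp (- (\<sigma> x)\<^sup>2)"
    proof -
      have "(\<sigma> x)\<^sup>2 = q ^ 4 * x + 1 / x - 2 * q\<^sup>2"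
        unfolding \<sigma> by (subst r(3), subst r(3)) (use r(1) assms in \<open>simp add: field_simps power2_eq_square power4_eq_xxxx\<close>)
      then show ?thesis by (simp add: f_def flip: exp_add)
    qed
    have hs: "h \<beta> (\<sigma> x) = exp (- (\<sigma> x)\<^sup>2) * (1 + (r - 1 / r) + \<beta> * (r - 1 / r)\<^sup>2)" for \<beta>
      unfolding h_def using assms by (simp add: \<sigma> power_mult_distrib)
    have Ek: "E * k \<beta> x = f x * ((1 + (r - 1 / r) + \<beta> * (r - 1 / r)\<^sup>2) / (2 * r ^ 3 / (r\<^sup>2 + 1)))" for \<beta>
      unfolding k_def J hs f E_def using assms by simp
    define L where "L = (1 + (r - 1 / r) + 0 * (r - 1 / r)\<^sup>2) / (2 * r ^ 3 / (r\<^sup>2 + 1))"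
    define R where "R = (1 + (r - 1 / r) + 1 / 2 * (r - 1 / r)\<^sup>2) / (2 * r ^ 3 / (r\<^sup>2 + 1))"
    have LR: "L \<le> 1" "1 \<le> R"
      unfolding L_def R_def pos_divide_le_eq[OF g] pos_le_divide_eq[OF g]
      using jacobian_quadratic_bounds[OF r(1)] by auto
    have "f x \<ge> 0" by (simp add: f_def)
    then show ?thesis
      unfolding Ek L_def[symmetric] R_def[symmetric]
      using mult_left_mono[OF LR(1)] mult_left_mono[OF LR(2)] by auto
  qed
  have int: "(\<lambda>x. E * k \<beta> x) absolutely_integrable_on {0<..}" for \<beta>
    using k[of \<beta>] by (intro set_integrable_mult_right) auto
  have val: "integral {0<..} (\<lambda>x. E * k \<beta> x) = E * (sqrt pi * (1 + \<beta> / q\<^sup>2 / 2))" for \<beta>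
    using k[of \<beta>] by simp
  have "continuous_on {0<..} f" unfolding f_def by (intro continuous_intros) auto
  then have "f \<in> borel_measurable (lebesgue_on {0<..})"
    by (intro continuous_imp_measurable_on_sets_lebesgue) auto
  then have f: "f absolutely_integrable_on {0<..}"
    by (rule measurable_bounded_by_integrable_imp_absolutely_integrable
        [OF _ _ set_lebesgue_integral_eq_integral(1)[OF int[of "1/2"]]])
      (use bounds in \<open>auto simp: f_def\<close>)
  then show "(\<lambda>x. exp (- (q ^ 4 * x) - 1 / x)) absolutely_integrable_on {0<..}" by (simp add: f_def)
  have I: "bessel_integral (q ^ 4) = integral {0<..} f" by (simp add: bessel_integral_def f_def)
  have "integral {0<..} (\<lambda>x. E * k 0 x) \<le> integral {0<..} f"
    by (intro integral_le set_lebesgue_integral_eq_integral(1)[OF int]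
        set_lebesgue_integral_eq_integral(1)[OF f]) (use bounds in auto)
  then show "sqrt pi * exp (- 2 * q\<^sup>2) / q ^ 3 \<le> bessel_integral (q ^ 4)"
    unfolding val I by (simp add: E_def mult_ac)
  have "integral {0<..} f \<le> integral {0<..} (\<lambda>x. E * k (1 / 2) x)"
    by (intro integral_le set_lebesgue_integral_eq_integral(1)[OF int]
        set_lebesgue_integral_eq_integral(1)[OF f]) (use bounds in auto)
  then show "bessel_integral (q ^ 4) \<le> sqrt pi * exp (- 2 * q\<^sup>2) / q ^ 3 * (1 + 1 / (4 * q\<^sup>2))"
    unfolding val I by (simp add: E_def mult_ac)
qed

section \<open>The explicit solution and its asymptotics\<close>

definition weight_moment :: "nat \<Rightarrow> real" where
  "weight_moment d = integral {0<..<1} (\<lambda>y. y ^ d * exp (- 1 / (1 - y)))"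

lemma absolutely_integrable_weight_moment:
  "(\<lambda>y. y ^ d * exp (- 1 / (1 - y)) :: real) absolutely_integrable_on {0<..<1}"
proof -
  have "continuous_on {0<..<1} (\<lambda>y::real. y ^ d * exp (- 1 / (1 - y)))"
    by (intro continuous_intros) auto
  then have "(\<lambda>y::real. y ^ d * exp (- 1 / (1 - y))) \<in> borel_measurable (lebesgue_on {0<..<1})"
    by (intro continuous_imp_measurable_on_sets_lebesgue) auto
  moreover have "norm (y ^ d * exp (- 1 / (1 - y))) \<le> 1" if "y \<in> {0<..<1}" for y :: real
    using that by (auto simp: abs_mult intro!: mult_le_one power_le_one)
  moreover have "(\<lambda>y::real. 1 :: real) integrable_on {0<..<1}"
    by (rule integrable_on_const) auto
  ultimately show ?thesis
    by (intro measurable_bounded_by_integrable_imp_absolutely_integrable) auto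
qed

lemma integrable_weight_moment:
  "(\<lambda>y. y ^ d * exp (- 1 / (1 - y)) :: real) integrable_on {0<..<1}"
  using absolutely_integrable_weight_moment set_lebesgue_integral_eq_integral(1) by blast

text \<open>
  Integrate the derivative of \<open>y^d (1 - y)^2 \<phi>(y)\<close>, where \<open>\<phi>' = - \<phi> / (1 - y)^2\<close>. The boundary term at
  \<open>y = 1\<close> vanishes, and the one at \<open>y = 0\<close> is present for \<open>d = 0\<close> only. For \<open>d = 0\<close> the
  truncated difference \<open>d - 1\<close> occurs with the factor 0.
\<close>

lemma weight_moment_recurrence:
  "real d * weight_moment (d - 1) + (real d + 2) * weight_moment (d + 1)
     = (2 * real d + 3) * weight_moment d - (if d = 0 then exp (- 1) else 0)"
proof -
  define \<phi> :: "real \<Rightarrow> real" where "\<phi> y = exp (- 1 / (1 - y))" for y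
  define F where "F y = y ^ d * (1 - y)\<^sup>2 * \<phi> y" for y
  define f where "f y = real d * (y ^ (d - 1) * \<phi> y) - (2 * real d + 3) * (y ^ d * \<phi> y)
    + (real d + 2) * (y ^ (d + 1) * \<phi> y)" for y
  have "(f has_integral (F 1 - F 0)) {0..1}"
  proof (rule fundamental_theorem_of_calculus_interior)
    show "continuous_on {0..1} F"
      unfolding continuous_on_eq_continuous_within
    proof
      fix y :: real assume y: "y \<in> {0..1}"
      show "continuous (at y within {0..1}) F"
      proof (cases "y = 1")
        case True
        \<comment> \<open>The formula for \<open>\<phi>\<close> yields \<open>\<phi> 1 = exp 0\<close>, so \<open>\<phi>\<close> jumps at 1; the factor \<open>(1 - y)^2\<close> makes \<open>F\<close> continuous.\<close>
        have "(F \<longlongrightarrow> 0) (at 1 within {0..1})"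
        proof (rule Lim_null_comparison)
          have "norm (F y) \<le> (1 - y)\<^sup>2" if "y \<in> {0..1}" for y
          proof -
            have "y ^ d * \<phi> y \<le> 1" "0 \<le> y ^ d * \<phi> y"
              using that by (auto simp: \<phi>_def intro!: mult_le_one power_le_one)
            then have "(1 - y)\<^sup>2 * (y ^ d * \<phi> y) \<le> (1 - y)\<^sup>2" "0 \<le> (1 - y)\<^sup>2 * (y ^ d * \<phi> y)"
              by (auto intro: mult_left_le)
            then show ?thesis by (simp add: F_def mult_ac)
          qed
          then show "\<forall>\<^sub>F y in at 1 within {0..1}. norm (F y) \<le> (1 - y)\<^sup>2"
            by (simp add: eventually_at_filter)
          show "((\<lambda>y::real. (1 - y)\<^sup>2) \<longlongrightarrow> 0) (at 1 within {0..1})"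
            by (rule tendsto_eq_intros refl | simp)+
        qed
        then show ?thesis using True by (simp add: continuous_within F_def)
      next
        case False
        then show ?thesis
          unfolding F_def \<phi>_def by (intro continuous_intros) auto
      qed
    qed
  next
    fix y :: real assume y: "y \<in> {0<..<1}"
    have "(\<phi> has_real_derivative - \<phi> y / (1 - y)\<^sup>2) (at y)"
      unfolding \<phi>_def using y
      by (auto intro!: derivative_eq_intros simp: power2_eq_square divide_simps)
    then have "(F has_real_derivative
        (real d * y ^ (d - 1) * (1 - y)\<^sup>2 - 2 * (1 - y) * y ^ d) * \<phi> y
          + y ^ d * (1 - y)\<^sup>2 * (- \<phi> y / (1 - y)\<^sup>2)) (at y)"
      unfolding F_def by (auto intro!: derivative_eq_intros simp: algebra_simps)
    also have "y ^ d * (1 - y)\<^sup>2 * (- \<phi> y / (1 - y)\<^sup>2) = - (y ^ d * \<phi> y)"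
      using y by simp
    also have "(real d * y ^ (d - 1) * (1 - y)\<^sup>2 - 2 * (1 - y) * y ^ d) * \<phi> y
          + - (y ^ d * \<phi> y) = f y"
    proof (cases d)
      case 0
      then show ?thesis using y by (simp add: f_def algebra_simps)
    next
      case (Suc m)
      then show ?thesis using y by (simp add: f_def algebra_simps power2_eq_square)
    qed
    finally show "(F has_vector_derivative f y) (at y)"
      by (simp add: has_real_derivative_iff_has_vector_derivative)
  qed auto
  then have "(f has_integral (F 1 - F 0)) {0<..<1}"
    using has_integral_Icc_iff_Ioo by blast
  moreover have "F 1 - F 0 = - (if d = 0 then exp (- 1) else 0)"
    by (simp add: F_def \<phi>_def)
  moreover have "(f has_integral (real d * weight_moment (d - 1) - (2 * real d + 3) * weight_moment d
      + (real d + 2) * weight_moment (d + 1))) {0<..<1}"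
    unfolding f_def weight_moment_def \<phi>_def
    by (intro has_integral_add has_integral_diff has_integral_mult_right
        integrable_integral integrable_weight_moment)
  ultimately have "real d * weight_moment (d - 1) - (2 * real d + 3) * weight_moment d
      + (real d + 2) * weight_moment (d + 1) = - (if d = 0 then exp (- 1) else 0)"
    by (metis has_integral_unique)
  then show ?thesis by linarith
qed

lemma weight_moment_nonneg: "weight_moment d \<ge> 0"
  unfolding weight_moment_def by (intro integral_nonneg integrable_weight_moment) auto

lemma weight_moment_le: "(real d + 1) * weight_moment d \<le> 1"
proof -
  have "((\<lambda>y::real. (1 + real d) * y ^ d) has_integral (1 ^ Suc d - 0 ^ Suc d)) {0..1}"
    by (rule fundamental_theorem_of_calculus)
      (use DERIV_pow[of "Suc d"] in \<open>auto simp flip: has_real_derivative_iff_has_vector_derivative\<close>)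
  then have upper: "((\<lambda>y::real. (1 + real d) * y ^ d) has_integral 1) {0<..<1}"
    by (simp add: has_integral_Icc_iff_Ioo)
  have "((\<lambda>y. (1 + real d) * (y ^ d * exp (- 1 / (1 - y))))
      has_integral (1 + real d) * weight_moment d) {0<..<1}"
    unfolding weight_moment_def by (intro has_integral_mult_right integrable_integral integrable_weight_moment)
  then have "(1 + real d) * weight_moment d \<le> 1"
  proof (rule has_integral_le[OF _ upper])
    fix y :: real assume "y \<in> {0<..<1}"
    then have "y ^ d * exp (- 1 / (1 - y)) \<le> y ^ d" by (intro mult_left_le) auto
    then show "(1 + real d) * (y ^ d * exp (- 1 / (1 - y))) \<le> (1 + real d) * y ^ d"
      by (intro mult_left_mono) auto
  qed
  then show ?thesis by (simp add: add.commute)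
qed

text \<open>
  The middle term equals \<open>1 / 2 + coth (x / 2) / 2\<close>, and \<open>coth\<close> differs from its polar part at 0 by
  a nonnegative function that is at most linear. The constant \<open>1 / 4\<close> comes from the
  quadratic Taylor bound for \<open>exp\<close>.
\<close>

lemma coth_bounds:
  fixes x :: real
  assumes "x > 0"
  shows "1 / x + 1 / 2 \<le> 1 / (1 - exp (- x))" "1 / (1 - exp (- x)) \<le> 1 / x + 1 / 2 + x / 4"
proof -
  have pos: "1 - exp (- x) > 0" using assms by simp
  have mono: "0 \<le> x * (1 + exp (- x)) - 2 * (1 - exp (- x))"
  proof -
    let ?f = "\<lambda>x::real. x * (1 + exp (- x)) - 2 * (1 - exp (- x))"
    have "?f 0 \<le> ?f x"
    proof (rule DERIV_nonneg_imp_nondecreasing[of 0 x])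
      fix t :: real assume "0 \<le> t"
      have "(?f has_real_derivative 1 - (1 + t) * exp (- t)) (at t)"
        by (auto intro!: derivative_eq_intros simp: algebra_simps)
      moreover have "(1 + t) * exp (- t) \<le> exp t * exp (- t)"
        using exp_ge_add_one_self by (intro mult_right_mono) auto
      ultimately show "\<exists>y. (?f has_real_derivative y) (at t) \<and> 0 \<le> y"
        by (auto simp flip: exp_add)
    qed (use assms in auto)
    then show ?thesis by simp
  qed
  then show "1 / x + 1 / 2 \<le> 1 / (1 - exp (- x))"
    using assms pos by (simp add: field_simps)
  have "exp x \<ge> 1 + x + x\<^sup>2 / 2" using exp_lower_Taylor_quadratic[of x] assms by simp
  then have "1 / (exp x - 1) \<le> 1 / (x + x\<^sup>2 / 2)"
    using assms by (intro divide_left_mono mult_pos_pos) (auto intro!: add_pos_pos)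
  also have "\<dots> \<le> 1 / x - 1 / 2 + x / 4"
  proof -
    have "1 / x - 1 / 2 + x / 4 - 1 / (x + x\<^sup>2 / 2) = x\<^sup>2 / (4 * (2 + x))"
    proof -
      have "x + x\<^sup>2 / 2 = x * (2 + x) / 2" by (simp add: power2_eq_square algebra_simps)
      moreover have "2 + x \<noteq> 0" "x * x + x * 2 > 0" using assms by (auto intro!: add_pos_pos)
      ultimately show ?thesis
        using assms by (simp add: divide_simps) (simp add: algebra_simps power2_eq_square)
    qed
    also have "\<dots> \<ge> 0" using assms by simp
    finally show ?thesis by linarith
  qed
  moreover have "1 / (1 - exp (- x)) = 1 + 1 / (exp x - 1)"
    using assms by (simp add: exp_minus divide_simps)
  ultimately show "1 / (1 - exp (- x)) \<le> 1 / x + 1 / 2 + x / 4" by linarith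
qed

text \<open>
  The constant term \<open>1 / 2\<close> in \<open>coth_bounds\<close> gives the factor \<open>exp (- 1 / 2)\<close>, and the linear term only
  shifts the argument of the Bessel integral.
\<close>

lemma weight_moment_bessel_bounds:
  "exp (- 1 / 2) * bessel_integral (real d + 5 / 4) \<le> weight_moment d"
  "weight_moment d \<le> exp (- 1 / 2) * bessel_integral (real d + 1)"
proof -
  define g where "g x = exp (- (real d + 1) * x - 1 / (1 - exp (- x)))" for x :: real
  have img: "(\<lambda>x. exp (- x)) ` {0<..} = {0<..<1::real}"
  proof (intro equalityI subsetI)
    fix y :: real assume "y \<in> {0<..<1}"
    then show "y \<in> (\<lambda>x. exp (- x)) ` {0<..}"
      by (intro image_eqI[of _ _ "- ln y"]) auto
  qed auto
  have "(\<lambda>x::real. \<bar>- exp (- x)\<bar> * (exp (- x) ^ d * exp (- 1 / (1 - exp (- x))))) absolutely_integrable_on {0<..}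
     \<and> integral {0<..} (\<lambda>x. \<bar>- exp (- x)\<bar> * (exp (- x) ^ d * exp (- 1 / (1 - exp (- x))))) = weight_moment d"
    by (rule iffD2[OF has_absolute_integral_change_of_variables_1'
        [where g = "\<lambda>x::real. exp (- x)" and g' = "\<lambda>x. - exp (- x)" and S = "{0<..}"
           and f = "\<lambda>y. y ^ d * exp (- 1 / (1 - y))"]])
      (use absolutely_integrable_weight_moment[of d] in
        \<open>auto simp: img weight_moment_def inj_on_def intro!: derivative_eq_intros\<close>)
  moreover have "\<bar>- exp (- x)\<bar> * (exp (- x) ^ d * exp (- 1 / (1 - exp (- x)))) = g x" for x
  proof -
    have "exp (- x) ^ d = exp (real d * - x)" by (simp only: exp_of_nat_mult)
    then have "\<bar>- exp (- x)\<bar> * (exp (- x) ^ d * exp (- 1 / (1 - exp (- x))))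
        = exp (- x + (real d * - x + - 1 / (1 - exp (- x))))"
      by (simp only: exp_add abs_minus abs_exp_cancel)
    also have "- x + (real d * - x + - 1 / (1 - exp (- x))) = - (real d + 1) * x - 1 / (1 - exp (- x))"
      by (simp add: algebra_simps)
    finally show ?thesis by (simp only: g_def)
  qed
  ultimately have g: "g integrable_on {0<..}" "integral {0<..} g = weight_moment d"
    using set_lebesgue_integral_eq_integral(1) by auto
  have int: "(\<lambda>x. exp (- (a * x) - 1 / x)) integrable_on {0<..}" if "a > 0" for a :: real
  proof -
    have "sqrt (sqrt a) ^ 4 = ((sqrt (sqrt a))\<^sup>2)\<^sup>2" by (simp only: power_mult[symmetric]) simp
    then have "sqrt (sqrt a) ^ 4 = a" using that by simp
    then show ?thesis
      using bessel_integral_bounds(1)[of "sqrt (sqrt a)"] that set_lebesgue_integral_eq_integral(1) by auto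
  qed
  have low: "exp (- 1 / 2) * exp (- ((real d + 5 / 4) * x) - 1 / x) \<le> g x"
    and up: "g x \<le> exp (- 1 / 2) * exp (- ((real d + 1) * x) - 1 / x)" if "x > 0" for x
    unfolding g_def exp_add[symmetric] exp_le_cancel_iff
    using coth_bounds[OF that] by (simp_all add: distrib_right left_diff_distrib)
  show "exp (- 1 / 2) * bessel_integral (real d + 5 / 4) \<le> weight_moment d"
    unfolding bessel_integral_def g(2)[symmetric] integral_mult_right[symmetric]
    by (intro integral_le g(1) integrable_on_mult_right int) (use low in auto)
  show "weight_moment d \<le> exp (- 1 / 2) * bessel_integral (real d + 1)"
    unfolding bessel_integral_def g(2)[symmetric] integral_mult_right[symmetric]
    by (intro integral_le g(1) integrable_on_mult_right int) (use up in auto)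
qed

lemma bessel_integral_asymp:
  fixes b :: real
  assumes "b > 0"
  shows "(\<lambda>d. bessel_integral (real d + b)) \<sim>[at_top] (\<lambda>d. sqrt pi * real d powr (- 3 / 4) * exp (- 2 * sqrt (real d)))"
  (is "_ \<sim>[_] ?rhs")
proof -
  define A where "A d = sqrt pi * exp (- 2 * sqrt (real d + b)) / (real d + b) powr (3 / 4)" for d
  have bounds: "A d \<le> bessel_integral (real d + b)"
    "bessel_integral (real d + b) \<le> A d * (1 + 1 / (4 * sqrt (real d + b)))" for d
  proof -
    define q where "q = (real d + b) powr (1 / 4)"
    have pos: "real d + b > 0" using assms by (simp add: add_nonneg_pos)
    then have q: "q > 0" "q ^ 4 = real d + b" "q\<^sup>2 = sqrt (real d + b)" "q ^ 3 = (real d + b) powr (3 / 4)"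
      by (auto simp: q_def powr_powr powr_half_sqrt simp flip: powr_realpow)
    show "A d \<le> bessel_integral (real d + b)"
      "bessel_integral (real d + b) \<le> A d * (1 + 1 / (4 * sqrt (real d + b)))"
      using bessel_integral_bounds(2,3)[OF q(1)] by (simp_all add: A_def q)
  qed
  have "A \<sim>[at_top] ?rhs"
    unfolding A_def by real_asymp
  moreover have "(\<lambda>d. A d * (1 + 1 / (4 * sqrt (real d + b)))) \<sim>[at_top] ?rhs"
    unfolding A_def by real_asymp
  ultimately show ?thesis
    by (rule asymp_equiv_sandwich_real) (use bounds in auto)
qed

lemma weight_moment_asymp:
  "(\<lambda>d. exp 1 * (real d + 1) * weight_moment d) \<sim>[at_top]
    (\<lambda>d. (exp 1 * pi) powr (1/2) * real d powr (1/4) * exp (- 2 * sqrt (real d)))"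
proof -
  define R where "R d = exp (- 1 / 2) * (sqrt pi * real d powr (- 3 / 4) * exp (- 2 * sqrt (real d)))" for d :: nat
  have "(\<lambda>d. exp (- 1 / 2) * bessel_integral (real d + b)) \<sim>[at_top] R" if "b > 0" for b
    unfolding R_def by (rule asymp_equiv_mult[OF asymp_equiv_refl bessel_integral_asymp[OF that]])
  from this[of "5 / 4", simplified] this[of 1, simplified] have "weight_moment \<sim>[at_top] R"
    by (rule asymp_equiv_sandwich_real) (use weight_moment_bessel_bounds in simp)
  moreover have "(\<lambda>d. exp 1 * (real d + 1)) \<sim>[at_top] (\<lambda>d. exp 1 * real d)"
    by real_asymp
  ultimately have "(\<lambda>d. exp 1 * (real d + 1) * weight_moment d) \<sim>[at_top] (\<lambda>d. exp 1 * real d * R d)"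
    by (rule asymp_equiv_mult[rotated])
  also have "\<dots> \<sim>[at_top] (\<lambda>d. (exp 1 * pi) powr (1/2) * real d powr (1/4) * exp (- 2 * sqrt (real d)))"
  proof -
    have c: "(exp 1 * pi) powr (1/2) = exp 1 * exp (- 1 / 2) * sqrt pi"
      by (simp add: powr_mult powr_half_sqrt powr_def[of "exp 1"] flip: exp_add)
    have p: "real d powr (1 / 4) = real d * real d powr (- 3 / 4)" for d
      by (cases "d = 0") (auto simp: powr_mult_base)
    show ?thesis unfolding c R_def p by (simp only: mult_ac asymp_equiv_refl)
  qed
  finally show ?thesis .
qed

theorem theorem3:
  fixes M :: "'w measure" and U V :: "nat \<Rightarrow> 'w \<Rightarrow> nat" and c :: "nat \<Rightarrow> real"
  assumes "duplication_deletion_process M U V"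
    and "\<And>d. AE \<omega> in M.
      (\<lambda>n. real (degree_count (\<lambda>k. U k \<omega>) (\<lambda>k. V k \<omega>) n d) / real (n + 1)) \<longlonglongrightarrow> c d"
  shows "c \<sim>[at_top]
    (\<lambda>d. (exp 1 * pi) powr (1/2) * real d powr (1/4) * exp (- 2 * sqrt (real d)))"
proof -
  interpret duplication_deletion_process M U V by fact
  note lim = mean_count_tendsto[OF assms(2)]
  define c' where "c' d = exp 1 * (real d + 1) * weight_moment d" for d
  have "c = c'"
  proof (rule bounded_recurrence_solution_unique[where B = "exp 1"])
    show "3 * c 0 = 1 + c 1" by (rule mean_count_limit_recurrence(1)[OF lim(1)])
    show "(2 * real d + 3) * c d = (real d + 1) * (c (d - 1) + c (d + 1))" if "d \<ge> 1" for d
      by (rule mean_count_limit_recurrence(2)[OF lim(1) that])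
    show "\<bar>c d\<bar> \<le> exp 1" for d
      using lim(2,3)[of d] exp_ge_add_one_self[of 1] by linarith
    have "exp 1 * (3 * weight_moment 0 - 2 * weight_moment 1) = 1"
      using weight_moment_recurrence[of 0] by (simp flip: exp_add)
    then show "3 * c' 0 = 1 + c' 1" by (simp add: c'_def algebra_simps)
    show "(2 * real d + 3) * c' d = (real d + 1) * (c' (d - 1) + c' (d + 1))" if "d \<ge> 1" for d
    proof -
      have "c' (d - 1) + c' (d + 1)
          = exp 1 * (real d * weight_moment (d - 1) + (real d + 2) * weight_moment (d + 1))"
        using that by (simp add: c'_def of_nat_diff algebra_simps)
      also have "\<dots> = exp 1 * ((2 * real d + 3) * weight_moment d)"
        unfolding weight_moment_recurrence using that by simp
      finally show ?thesis by (simp add: c'_def)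
    qed
    show "\<bar>c' d\<bar> \<le> exp 1" for d
      using weight_moment_le[of d] weight_moment_nonneg[of d] by (simp add: c'_def abs_mult)
  qed
  then show ?thesis using weight_moment_asymp by (simp add: c'_def[abs_def])
qed

end
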